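(* Let $c_{\min}\in(0,1]$ and consider instances of the Budgeted Influence Maximization with Augmentation problem (BIMA) in which every edge cost satisfies $c_e\ge c_{\min}$. Then selecting a set $A$ of $k$ seed nodes that maximizes $\sigma(A,\emptyset)$ (and adding no edges) guarantees an approximation factor of $c_{\min}$, i.e. $\sigma(A,\emptyset)\ge c_{\min}\,\sigma(A^*,S^* )$ where $(A^*,S^* )$ is an optimal solution of BIMA. Consequently, there is a polynomial-time algorithm for BIMA on such instances with approximation factor $\left(1-\frac1e\right)c_{\min}$.
   Context: Setting. $G=(V,E,p,c)$ is a finite directed graph with propagation probabilities $p:V\times V\to[0,1]$ and edge-addition costs $c:V\times V\to[0,1]$. Independent Cascade Model: for a set $S\subseteq (V\times V)\setminus E$, let $G(S)=(V,E\cup S)$. A live-edge graph $X$ of $G(S)$ is the random subgraph on $V$ in which each edge $e\in E\cup S$ is kept independently with probability $p_e$; $\chi(S)$ is the set of all possible live-edge graphs of $G(S)$. For $A\subseteq V$, $R(A,X)$ is the set of nodes reachable in $X$ from some node of $A$ (including $A$), and $\sigma(A,S)=\sum_{X\in\chi(S)}\mathbb P[X]\,|R(A,X)|$ is the expected number of active nodes when $A$ is the set of seeds in $G(S)$. BIMA problem: given $G$ and a budget $k\in\mathbb N$, find $A\subseteq V$ and $S\subseteq (A\times V)\setminus E$ with $c(A,S):=|A|+\sum_{e\in S}c_e\le k$ maximizing $\sigma(A,S)$. Convention: the value $\sigma(A,S)$ is assumed to be computable (oracle access to $\sigma$); the additional factor $1+\epsilon$, for any $\epsilon>0$, coming from estimating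 $\sigma$ by sampling is omitted from approximation factors. *)

theory Defs
  imports
    "HOL-Probability.Probability"
    "HOL-Library.Log_Nat"
    "HOL-Computational_Algebra.Polynomial"
begin

section \<open>Influence maximization with edge addition\<close>

record 'v aug_graph =
  verts :: "'v set"
  edges :: "('v \<times> 'v) set"
  prob :: "'v \<times> 'v \<Rightarrow> real"
  cost :: "'v \<times> 'v \<Rightarrow> real"

definition wf_aug_graph :: "'v aug_graph \<Rightarrow> bool" where
  "wf_aug_graph G \<longleftrightarrow>
     finite (verts G) \<and> edges G \<subseteq> verts G \<times> verts G \<and>
     (\<forall>e \<in> verts G \<times> verts G. prob G e \<in> {0..1} \<and> cost G e \<in> {0..1})"

text \<open>A live-edge graph of \<open>G(S)\<close> always has node set \<open>verts G\<close>, so it is represented by its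
  set of edges. \<open>Pi_pmf\<close> is the law of independent coins, one for each edge of \<open>G(S)\<close>.\<close>

definition live_edge_graphs :: "'v aug_graph \<Rightarrow> ('v \<times> 'v) set \<Rightarrow> ('v \<times> 'v) set set" where
  "live_edge_graphs G S = Pow (edges G \<union> S)"

definition live_edge_pmf :: "'v aug_graph \<Rightarrow> ('v \<times> 'v) set \<Rightarrow> ('v \<times> 'v) set pmf" where
  "live_edge_pmf G S =
     map_pmf (\<lambda>kept. {e \<in> edges G \<union> S. kept e})
       (Pi_pmf (edges G \<union> S) False (\<lambda>e. bernoulli_pmf (prob G e)))"

definition reach :: "'v set \<Rightarrow> ('v \<times> 'v) set \<Rightarrow> 'v set" where
  "reach A X = X\<^sup>* `` A"

definition influence :: "'v aug_graph \<Rightarrow> 'v set \<Rightarrow> ('v \<times> 'v) set \<Rightarrow> real" where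
  "influence G A S =
     (\<Sum>X \<in> live_edge_graphs G S. pmf (live_edge_pmf G S) X * real (card (reach A X)))"

definition bima_feasible :: "'v aug_graph \<Rightarrow> nat \<Rightarrow> 'v set \<Rightarrow> ('v \<times> 'v) set \<Rightarrow> bool" where
  "bima_feasible G k A S \<longleftrightarrow>
     A \<subseteq> verts G \<and> S \<subseteq> (A \<times> verts G) - edges G \<and>
     real (card A) + (\<Sum>e\<in>S. cost G e) \<le> real k"

definition bima_optimal :: "'v aug_graph \<Rightarrow> nat \<Rightarrow> 'v set \<Rightarrow> ('v \<times> 'v) set \<Rightarrow> bool" where
  "bima_optimal G k A S \<longleftrightarrow>
     bima_feasible G k A S \<and>
     (\<forall>B T. bima_feasible G k B T \<longrightarrow> influence G B T \<le> influence G A S)"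

definition bima_approx ::
  "real \<Rightarrow> 'v aug_graph \<Rightarrow> nat \<Rightarrow> 'v set \<Rightarrow> ('v \<times> 'v) set \<Rightarrow> bool" where
  "bima_approx \<alpha> G k A S \<longleftrightarrow>
     bima_feasible G k A S \<and>
     (\<forall>A' S'. bima_optimal G k A' S' \<longrightarrow> influence G A S \<ge> \<alpha> * influence G A' S')"

text \<open>If the budget exceeds the number of nodes, then all nodes are selected.\<close>

definition seed_sets :: "'v aug_graph \<Rightarrow> nat \<Rightarrow> 'v set set" where
  "seed_sets G k = {A. A \<subseteq> verts G \<and> card A = min k (card (verts G))}"

definition optimal_seed_set :: "'v aug_graph \<Rightarrow> nat \<Rightarrow> 'v set \<Rightarrow> bool" where
  "optimal_seed_set G k A \<longleftrightarrow>
     A \<in> seed_sets G k \<and> (\<forall>B \<in> seed_sets G k. influence G B {} \<le> influence G A {})"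

definition costs_at_least :: "real \<Rightarrow> 'v aug_graph \<Rightarrow> bool" where
  "costs_at_least c G \<longleftrightarrow> (\<forall>e \<in> verts G \<times> verts G. c \<le> cost G e)"


section \<open>Polynomial-time algorithms with access to the influence oracle\<close>

text \<open>
  Algorithms are programs of a while language over natural numbers and reals, with
  two-dimensional arrays (a set of nodes \<open>a\<close> is the set of indices \<open>v\<close> with \<open>a[v,0] \<noteq> 0\<close>, a set of
  pairs \<open>b\<close> the set of all \<open>(u,v)\<close> with \<open>b[u,v] \<noteq> 0\<close>). Assignments, tests and oracle calls
  take one step each; evaluating an expression adds only a constant factor, as the expressions
  belong to a fixed program. Arithmetic is restricted to addition and subtraction: the length of
  numbers then grows by a constant per step, so that the unit cost measure is
  polynomially equivalent to counting bit operations. Multiplication or rounding at unit cost would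
  give the model more than polynomial-time power.
\<close>

type_synonym vname = string

datatype nexp =
    NConst nat
  | NVar vname
  | NGet vname nexp nexp
  | NAdd nexp nexp
  | NSub nexp nexp

datatype rexp =
    RNat nexp
  | RVar vname
  | RGet vname nexp nexp
  | RAdd rexp rexp
  | RSub rexp rexp

datatype bexp =
    NLess nexp nexp
  | RLess rexp rexp
  | BNot bexp
  | BAnd bexp bexp

datatype com =
    Skip
  | NAssign vname nexp
  | NPut vname nexp nexp nexp
  | RAssign vname rexp
  | RPut vname nexp nexp rexp
  | Query vname vname vname
  | Seq com com
  | Cond bexp com com
  | While bexp com

record store =
  nvar :: "vname \<Rightarrow> nat"
  narr :: "vname \<Rightarrow> nat \<Rightarrow> nat \<Rightarrow> nat"
  rvar :: "vname \<Rightarrow> real"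
  rarr :: "vname \<Rightarrow> nat \<Rightarrow> nat \<Rightarrow> real"

fun nval :: "nexp \<Rightarrow> store \<Rightarrow> nat" where
  "nval (NConst m) s = m"
| "nval (NVar x) s = nvar s x"
| "nval (NGet a d e) s = narr s a (nval d s) (nval e s)"
| "nval (NAdd d e) s = nval d s + nval e s"
| "nval (NSub d e) s = nval d s - nval e s"

fun rval :: "rexp \<Rightarrow> store \<Rightarrow> real" where
  "rval (RNat d) s = real (nval d s)"
| "rval (RVar x) s = rvar s x"
| "rval (RGet a d e) s = rarr s a (nval d s) (nval e s)"
| "rval (RAdd d e) s = rval d s + rval e s"
| "rval (RSub d e) s = rval d s - rval e s"

fun bval :: "bexp \<Rightarrow> store \<Rightarrow> bool" where
  "bval (NLess d e) s \<longleftrightarrow> nval d s < nval e s"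
| "bval (RLess d e) s \<longleftrightarrow> rval d s < rval e s"
| "bval (BNot b) s \<longleftrightarrow> \<not> bval b s"
| "bval (BAnd b b') s \<longleftrightarrow> bval b s \<and> bval b' s"

definition node_set :: "vname \<Rightarrow> store \<Rightarrow> nat set" where
  "node_set a s = {v. narr s a v 0 \<noteq> 0}"

definition pair_set :: "vname \<Rightarrow> store \<Rightarrow> (nat \<times> nat) set" where
  "pair_set b s = {(u, v). narr s b u v \<noteq> 0}"

definition put :: "(vname \<Rightarrow> nat \<Rightarrow> nat \<Rightarrow> 'a) \<Rightarrow> vname \<Rightarrow> nat \<Rightarrow> nat \<Rightarrow> 'a \<Rightarrow>
    vname \<Rightarrow> nat \<Rightarrow> nat \<Rightarrow> 'a" where
  "put f a i j y = f(a := (f a)(i := (f a i)(j := y)))"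

type_synonym set_oracle = "nat set \<Rightarrow> (nat \<times> nat) set \<Rightarrow> real option"

text \<open>\<open>exec orc p s t s'\<close>: started in \<open>s\<close>, the program \<open>p\<close> halts in \<open>s'\<close> after \<open>t\<close> steps.
  A query outside the domain of the oracle has no transition.\<close>

inductive exec :: "set_oracle \<Rightarrow> com \<Rightarrow> store \<Rightarrow> nat \<Rightarrow> store \<Rightarrow> bool" for orc :: set_oracle where
  Skip: "exec orc Skip s 1 s"
| NAssign: "exec orc (NAssign x d) s 1 (s\<lparr>nvar := (nvar s)(x := nval d s)\<rparr>)"
| NPut: "exec orc (NPut a i j d) s 1
    (s\<lparr>narr := put (narr s) a (nval i s) (nval j s) (nval d s)\<rparr>)"
| RAssign: "exec orc (RAssign x d) s 1 (s\<lparr>rvar := (rvar s)(x := rval d s)\<rparr>)"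
| RPut: "exec orc (RPut a i j d) s 1
    (s\<lparr>rarr := put (rarr s) a (nval i s) (nval j s) (rval d s)\<rparr>)"
| Query: "orc (node_set a s) (pair_set b s) = Some y \<Longrightarrow>
    exec orc (Query x a b) s 1 (s\<lparr>rvar := (rvar s)(x := y)\<rparr>)"
| Seq: "exec orc p s t s' \<Longrightarrow> exec orc q s' t' s'' \<Longrightarrow> exec orc (Seq p q) s (t + t') s''"
| CondTrue: "bval b s \<Longrightarrow> exec orc p s t s' \<Longrightarrow> exec orc (Cond b p q) s (1 + t) s'"
| CondFalse: "\<not> bval b s \<Longrightarrow> exec orc q s t s' \<Longrightarrow> exec orc (Cond b p q) s (1 + t) s'"
| WhileTrue: "bval b s \<Longrightarrow> exec orc p s t s' \<Longrightarrow> exec orc (While b p) s' t' s'' \<Longrightarrow>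
    exec orc (While b p) s (1 + t + t') s''"
| WhileFalse: "\<not> bval b s \<Longrightarrow> exec orc (While b p) s 1 s"

definition influence_oracle :: "nat aug_graph \<Rightarrow> set_oracle" where
  "influence_oracle G A S =
     (if A \<subseteq> verts G \<and> S \<subseteq> (verts G \<times> verts G) - edges G
      then Some (influence G A S) else None)"

text \<open>The encoding of an instance whose nodes are numbered from \<open>0\<close>.\<close>

definition input_store :: "nat aug_graph \<Rightarrow> nat \<Rightarrow> store" where
  "input_store G k = \<lparr>
     nvar = (\<lambda>_. 0)(''n'' := card (verts G), ''k'' := k),
     narr = (\<lambda>_ _ _. 0)(''E'' := (\<lambda>u v. if (u, v) \<in> edges G then 1 else 0)),
     rvar = (\<lambda>_. 0),
     rarr = (\<lambda>_ _ _. 0)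
       (''p'' := (\<lambda>u v. if (u, v) \<in> verts G \<times> verts G then prob G (u, v) else 0),
        ''c'' := (\<lambda>u v. if (u, v) \<in> verts G \<times> verts G then cost G (u, v) else 0))\<rparr>"

text \<open>The input consists of three square matrices of order \<open>card (verts G)\<close> and of the binary
  representation of \<open>k\<close>, so its length is polynomially equivalent to the following.\<close>

definition input_size :: "nat aug_graph \<Rightarrow> nat \<Rightarrow> nat" where
  "input_size G k = card (verts G) + floorlog 2 k"

definition poly_time_bima_approx :: "com \<Rightarrow> real \<Rightarrow> (nat aug_graph \<Rightarrow> bool) \<Rightarrow> bool" where
  "poly_time_bima_approx p \<alpha> I \<longleftrightarrow>
     (\<exists>q :: nat poly. \<forall>G n k.
        wf_aug_graph G \<and> verts G = {..<n} \<and> I G \<longrightarrow>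
        (\<exists>t s. exec (influence_oracle G) p (input_store G k) t s \<and>
               t \<le> poly q (input_size G k) \<and>
               bima_approx \<alpha> G k (node_set ''A'' s) (pair_set ''S'' s)))"

end

(* Replacing each added edge (a,v) by the seed v does not decrease the influence, so an optimal
   solution is dominated by a pure seed set B of size at most k / c_min. Deleting from B, one at a
   time, a node of smallest marginal contribution never decreases the ratio f(B) / |B|, by
   submodularity, and leaves a k-subset with at least the fraction c_min of the value.
   The algorithm is the greedy one, which is a (1 - 1/e)-approximation for the best seed set. *)

theory Submission
  imports Defs
begin

section \<open>Monotone submodular functions\<close>

definition submodular_on :: "'a set \<Rightarrow> ('a set \<Rightarrow> real) \<Rightarrow> bool" where
  "submodular_on V f \<longleftrightarrow>
     (\<forall>A B. \<forall>x\<in>V. A \<subseteq> B \<longrightarrow> B \<subseteq> V \<longrightarrow> x \<notin> B \<longrightarrow> f (insert x B) - f B \<le> f (insert x A) - f A)"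

lemma submodular_onD:
  assumes "submodular_on V f" "A \<subseteq> B" "B \<subseteq> V" "x \<in> V" "x \<notin> B"
  shows "f (insert x B) - f B \<le> f (insert x A) - f A"
  using assms unfolding submodular_on_def by blast

text \<open>Adding the elements of \<open>B\<close> to \<open>A\<close> one at a time telescopes,
  and each gain is at most the gain over \<open>A\<close> alone. Elements already in
  \<open>A\<close> gain nothing on either side.\<close>

lemma submodular_on_union_le:
  assumes sub: "submodular_on V f" and "finite B" "A \<subseteq> V" "B \<subseteq> V"
  shows "f (A \<union> B) \<le> f A + (\<Sum>v\<in>B. f (insert v A) - f A)"
  using \<open>finite B\<close> \<open>B \<subseteq> V\<close>
proof (induction B rule: finite_induct)
  case empty
  then show ?case by simp
next
  case (insert x B)
  have "f (A \<union> insert x B) - f (A \<union> B) \<le> f (insert x A) - f A"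
  proof (cases "x \<in> A \<union> B")
    case True
    then have "x \<in> A" using insert by auto
    then show ?thesis by (simp add: insert_absorb)
  next
    case False
    then show ?thesis
      using submodular_onD[OF sub, of A "A \<union> B" x] insert.prems \<open>A \<subseteq> V\<close> by simp
  qed
  then show ?case using insert by simp
qed

text \<open>When \<open>y\<close> joins \<open>B\<close>, the loss caused by deleting an old
  \<open>x\<close> can only shrink, while the new summand is exactly the increase from
  \<open>f B\<close> to \<open>f (insert y B)\<close>.\<close>

lemma submodular_on_sum_removal_le:
  assumes sub: "submodular_on V f" and "finite B" "B \<subseteq> V"
  shows "(\<Sum>x\<in>B. f B - f (B - {x})) \<le> f B - f {}"
  using \<open>finite B\<close> \<open>B \<subseteq> V\<close>
proof (induction B rule: finite_induct)
  case empty
  then show ?case by simp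
next
  case (insert y B)
  have "(\<Sum>x\<in>B. f (insert y B) - f (insert y B - {x})) \<le> (\<Sum>x\<in>B. f B - f (B - {x}))"
  proof (rule sum_mono)
    fix x assume "x \<in> B"
    then have "insert y B - {x} = insert y (B - {x})" using insert.hyps by auto
    then show "f (insert y B) - f (insert y B - {x}) \<le> f B - f (B - {x})"
      using submodular_onD[OF sub, of "B - {x}" B y] insert.hyps insert.prems by auto
  qed
  then show ?case using insert by simp
qed

text \<open>Induction on the number of elements still to be deleted; each deletion preserves the
  average value per element. The product form keeps the claim meaningful for
  \<open>k = 0\<close>.\<close>

lemma submodular_on_ex_subset_ratio:
  assumes sub: "submodular_on V f" and nonneg: "0 \<le> f {}"
    and "finite B" "B \<subseteq> V" "k \<le> card B"
  shows "\<exists>C \<subseteq> B. card C = k \<and> real k * f B \<le> real (card B) * f C"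
  using assms(3-5)
proof (induction "card B - k" arbitrary: B)
  case 0
  then show ?case by (intro exI[of _ B]) simp
next
  case (Suc d)
  define b where "b = card B"
  have b: "k < b" using Suc.hyps(2) by (simp add: b_def)
  \<comment> \<open>Averaging: the removal losses sum to at most \<open>f B\<close>, so some element
    loses at most the fraction \<open>1 / b\<close> of it.\<close>
  have "\<exists>x\<in>B. (real b - 1) * f B \<le> real b * f (B - {x})"
  proof (rule ccontr)
    assume "\<not> ?thesis"
    then have less: "\<And>x. x \<in> B \<Longrightarrow> real b * f (B - {x}) < (real b - 1) * f B" by force
    have "(\<Sum>x\<in>B. real b * f (B - {x})) < (\<Sum>x\<in>B. (real b - 1) * f B)"
      using less Suc.prems(1) b by (intro sum_strict_mono) (auto simp: b_def)
    then have "real b * (\<Sum>x\<in>B. f (B - {x})) < real b * ((real b - 1) * f B)"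
      by (simp add: sum_distrib_left b_def)
    then have "(\<Sum>x\<in>B. f (B - {x})) < (real b - 1) * f B"
      using b by simp
    moreover have "real b * f B - (\<Sum>x\<in>B. f (B - {x})) \<le> f B"
      using submodular_on_sum_removal_le[OF sub Suc.prems(1,2)] nonneg
      by (simp add: sum_subtractf b_def)
    ultimately show False by (simp add: algebra_simps)
  qed
  then obtain x where x: "x \<in> B" "(real b - 1) * f B \<le> real b * f (B - {x})" by blast
  have card: "card (B - {x}) = b - 1" using x Suc.prems(1) by (simp add: b_def)
  have "d = card (B - {x}) - k" using Suc.hyps(2) card by (simp add: b_def)
  moreover have "k \<le> card (B - {x})" using card b by simp
  moreover have "finite (B - {x})" "B - {x} \<subseteq> V" using Suc.prems by auto
  ultimately obtain C where C: "C \<subseteq> B - {x}" "card C = k"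
    "real k * f (B - {x}) \<le> real (card (B - {x})) * f C"
    using Suc.hyps(1)[of "B - {x}"] by blast
  have rb: "real (b - 1) = real b - 1" using b by simp
  have C3: "real k * f (B - {x}) \<le> (real b - 1) * f C" using C(3) card rb by simp
  have "real k * f B \<le> real b * f C"
  \<comment> \<open>The general case cancels the factor \<open>b - 1\<close>, which vanishes
    here.\<close>
  proof (cases "b = 1")
    case True
    then have "k = 0" using b by simp
    moreover have "C = {}" using C(1,2) \<open>k = 0\<close> Suc.prems(1) by (meson card_0_eq finite_Diff finite_subset)
    ultimately show ?thesis using nonneg by simp
  next
    case False
    have "(real b - 1) * (real k * f B) = real k * ((real b - 1) * f B)" by simp
    also have "\<dots> \<le> real k * (real b * f (B - {x}))" using x by (intro mult_left_mono) auto
    also have "\<dots> = real b * (real k * f (B - {x}))" by simp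
    also have "\<dots> \<le> real b * ((real b - 1) * f C)" using C3 by (intro mult_left_mono) auto
    finally have "(real b - 1) * (real k * f B) \<le> (real b - 1) * (real b * f C)"
      by (simp add: mult_ac)
    then show ?thesis using False b by simp
  qed
  then show ?case using C by (intro exI[of _ C]) (auto simp: b_def)
qed

text \<open>The gap to \<open>U\<close> is at most the sum of the marginal gains of the elements of
  \<open>U\<close> over \<open>A\<close>. There are at most \<open>m\<close> of them and each is at
  most \<open>f A' - f A\<close>, so one round closes at least \<open>1 / m\<close> of the
  gap.\<close>

lemma greedy_step:
  assumes sub: "submodular_on V f" and mono: "\<And>C D. C \<subseteq> D \<Longrightarrow> D \<subseteq> V \<Longrightarrow> f C \<le> f D"
    and "finite V" "A \<subseteq> V" "U \<subseteq> V" "card U \<le> m" "0 < m"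
    and best: "\<And>v. v \<in> V \<Longrightarrow> f (insert v A) \<le> f A'" and "f A \<le> f A'"
    and IH: "f U - f A \<le> (1 - 1 / real m) ^ i * f U"
  shows "f U - f A' \<le> (1 - 1 / real m) ^ Suc i * f U"
proof -
  have "f U \<le> f (A \<union> U)" using assms by (intro mono) auto
  also have "\<dots> \<le> f A + (\<Sum>v\<in>U. f (insert v A) - f A)"
    using assms finite_subset by (intro submodular_on_union_le[OF sub]) auto
  also have "(\<Sum>v\<in>U. f (insert v A) - f A) \<le> (\<Sum>v\<in>U. f A' - f A)"
    using best \<open>U \<subseteq> V\<close> by (intro sum_mono) auto
  \<comment> \<open>Passing from \<open>card U\<close> to \<open>m\<close> needs a nonnegative gain,
    hence \<open>f A \<le> f A'\<close>.\<close>
  also have "\<dots> \<le> real m * (f A' - f A)"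
    using assms by (simp add: mult_right_mono)
  finally have "(f U - f A) / real m \<le> f A' - f A"
    using \<open>0 < m\<close> by (simp add: field_simps)
  then have "f U - f A' \<le> (1 - 1 / real m) * (f U - f A)"
    by (simp add: field_simps)
  also have "\<dots> \<le> (1 - 1 / real m) * ((1 - 1 / real m) ^ i * f U)"
    using IH \<open>0 < m\<close> by (intro mult_left_mono) auto
  finally show ?thesis by simp
qed

text \<open>This is \<open>1 + x \<le> exp x\<close> at \<open>x = - 1 / m\<close>, raised to the
  power \<open>m\<close>; the base is nonnegative since \<open>m\<close> is at least 1.\<close>

lemma one_minus_inverse_power_le:
  assumes "0 < m"
  shows "(1 - 1 / real m) ^ m \<le> 1 / exp 1"
proof -
  have "(1 - 1 / real m) ^ m \<le> exp (- 1 / real m) ^ m"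
    using assms exp_ge_add_one_self[of "- 1 / real m"] by (intro power_mono) auto
  also have "\<dots> = exp (- 1)" using assms by (simp flip: exp_of_nat_mult)
  finally show ?thesis by (simp add: exp_minus field_simps)
qed

section \<open>The influence function\<close>

lemma reach_Un: "reach (A \<union> B) X = reach A X \<union> reach B X"
  by (auto simp: reach_def)

lemma reach_insert: "reach (insert x A) X = reach {x} X \<union> reach A X"
  by (auto simp: reach_def)

lemma reach_mono: "A \<subseteq> B \<Longrightarrow> reach A X \<subseteq> reach B X"
  by (auto simp: reach_def)

lemma reach_subset:
  assumes "X \<subseteq> V \<times> V" "A \<subseteq> V"
  shows "reach A X \<subseteq> V"
proof
  fix y assume "y \<in> reach A X"
  then obtain a where "a \<in> A" "(a, y) \<in> X\<^sup>*" by (auto simp: reach_def)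
  from this(2) this(1) show "y \<in> V"
    by (induction rule: rtrancl_induct) (use assms in auto)
qed

text \<open>After its last added edge a path uses edges of \<open>E\<close> only, and the head of
  that added edge is a seed on the right-hand side.\<close>

lemma reach_added_edges_subset:
  assumes "X \<subseteq> E \<union> S"
  shows "reach A X \<subseteq> reach (A \<union> snd ` S) (X \<inter> E)"
proof
  fix y assume "y \<in> reach A X"
  then obtain a where a: "a \<in> A" "(a, y) \<in> X\<^sup>*" by (auto simp: reach_def)
  from a(2) show "y \<in> reach (A \<union> snd ` S) (X \<inter> E)"
  proof (induction rule: rtrancl_induct)
    case base
    then show ?case using a(1) by (auto simp: reach_def)
  next
    case (step y z)
    show ?case
    proof (cases "(y, z) \<in> E")
      case True
      then show ?thesis using step by (auto simp: reach_def intro: rtrancl_into_rtrancl)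
    next
      case False
      then have "z \<in> snd ` S" using step assms by force
      then show ?thesis by (auto simp: reach_def)
    qed
  qed
qed

section \<open>Influence of seeds without added edges, as an expected coverage\<close>

context
  fixes G :: "'v aug_graph"
  assumes wf: "wf_aug_graph G"
begin

lemma finite_verts: "finite (verts G)"
  and edges_subset: "edges G \<subseteq> verts G \<times> verts G"
  using wf by (auto simp: wf_aug_graph_def)

lemma finite_edges: "finite (edges G)"
  using finite_verts edges_subset finite_subset by blast

lemma influence_nonneg: "0 \<le> influence G A S"
  unfolding influence_def by (intro sum_nonneg) auto

text \<open>Reachable sets are unions over the seeds, so this is submodularity of coverage: the
  overlap of \<open>reach {x} X\<close> with the covered set grows with that set. The additive form
  avoids subtraction on naturals.\<close>

lemma card_reach_submodular:
  assumes "X \<subseteq> verts G \<times> verts G" "A \<subseteq> B" "B \<subseteq> verts G" "x \<in> verts G"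
  shows "card (reach (insert x B) X) + card (reach A X)
    \<le> card (reach (insert x A) X) + card (reach B X)"
proof -
  have fin: "finite (reach C X)" if "C \<subseteq> verts G" for C
    using reach_subset[OF assms(1) that] finite_verts finite_subset by blast
  have f: "finite (reach {x} X)" "finite (reach A X)" "finite (reach B X)"
    using fin assms by auto
  have "card (reach {x} X \<inter> reach A X) \<le> card (reach {x} X \<inter> reach B X)"
    using f reach_mono[OF assms(2)] by (intro card_mono) auto
  then show ?thesis
    using card_Un_Int[OF f(1,2)] card_Un_Int[OF f(1,3)]
    unfolding reach_insert[of x A] reach_insert[of x B] by linarith
qed

text \<open>The weights of the live-edge graphs are nonnegative and do not depend on the seeds, so
  submodularity passes from each graph to the weighted sum.\<close>

lemma influence_submodular: "submodular_on (verts G) (\<lambda>A. influence G A {})"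
  unfolding submodular_on_def
proof (intro allI ballI impI)
  fix A B x assume *: "A \<subseteq> B" "B \<subseteq> verts G" "x \<in> verts G"
  have "influence G (insert x B) {} + influence G A {}
      \<le> influence G (insert x A) {} + influence G B {}"
    unfolding influence_def sum.distrib[symmetric] distrib_left[symmetric] of_nat_add[symmetric]
    using card_reach_submodular[OF _ *] edges_subset
    by (intro sum_mono mult_left_mono of_nat_mono) (auto simp: live_edge_graphs_def)
  then show "influence G (insert x B) {} - influence G B {}
      \<le> influence G (insert x A) {} - influence G A {}" by linarith
qed

lemma influence_mono:
  assumes "A \<subseteq> B" "B \<subseteq> verts G"
  shows "influence G A {} \<le> influence G B {}"
  unfolding influence_def
proof (intro sum_mono mult_left_mono of_nat_mono card_mono)
  fix X assume "X \<in> live_edge_graphs G {}"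
  then have "X \<subseteq> verts G \<times> verts G" using edges_subset by (auto simp: live_edge_graphs_def)
  then show "finite (reach B X)"
    using reach_subset[OF _ assms(2)] finite_verts finite_subset by metis
qed (use assms reach_mono in \<open>simp_all\<close>)

lemma influence_empty: "influence G {} S = 0"
  by (simp add: influence_def reach_def)

section \<open>Coupling live-edge graphs with and without added edges\<close>

lemma set_live_edge_pmf: "set_pmf (live_edge_pmf G S) \<subseteq> Pow (edges G \<union> S)"
  by (auto simp: live_edge_pmf_def)

lemma influence_eq_expectation:
  assumes "finite S"
  shows "influence G A S = measure_pmf.expectation (live_edge_pmf G S) (\<lambda>X. real (card (reach A X)))"
  using set_live_edge_pmf[of S] assms finite_edges
  by (subst integral_measure_pmf[of "live_edge_graphs G S"])
    (auto simp: influence_def live_edge_graphs_def)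

text \<open>Forgetting the coins of the added edges leaves independent coins on the original ones.
  This puts both influences on one probability space.\<close>

lemma live_edge_pmf_restrict:
  assumes "finite S"
  shows "live_edge_pmf G {} = map_pmf (\<lambda>X. X \<inter> edges G) (live_edge_pmf G S)"
proof -
  have "Pi_pmf (edges G) False (\<lambda>e. bernoulli_pmf (prob G e)) =
      map_pmf (\<lambda>f x. if x \<in> edges G then f x else False)
        (Pi_pmf (edges G \<union> S) False (\<lambda>e. bernoulli_pmf (prob G e)))"
    using assms finite_edges by (intro Pi_pmf_subset) auto
  then show ?thesis
    by (auto simp: live_edge_pmf_def pmf.map_comp o_def intro!: map_pmf_cong)
qed

text \<open>Under this coupling the inclusion of reachable sets holds for every outcome
  \<open>X\<close>, hence also in expectation.\<close>

lemma influence_added_edges_le: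
  assumes "A \<subseteq> verts G" "S \<subseteq> verts G \<times> verts G"
  shows "influence G A S \<le> influence G (A \<union> snd ` S) {}"
proof -
  have "finite S" using assms finite_verts finite_subset by blast
  then have finE: "finite (edges G \<union> S)" using finite_edges by simp
  have fin: "finite (set_pmf (live_edge_pmf G S))"
    using set_live_edge_pmf finE finite_subset by (metis finite_Pow_iff)
  have "influence G A S = measure_pmf.expectation (live_edge_pmf G S) (\<lambda>X. real (card (reach A X)))"
    using \<open>finite S\<close> by (rule influence_eq_expectation)
  also have "\<dots> \<le> measure_pmf.expectation (live_edge_pmf G S)
      (\<lambda>X. real (card (reach (A \<union> snd ` S) (X \<inter> edges G))))"
  proof (intro integral_mono_AE integrable_measure_pmf_finite fin AE_pmfI of_nat_mono card_mono)
    fix X assume "X \<in> set_pmf (live_edge_pmf G S)"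
    then have "X \<subseteq> edges G \<union> S" using set_live_edge_pmf by auto
    then show "reach A X \<subseteq> reach (A \<union> snd ` S) (X \<inter> edges G)"
      by (rule reach_added_edges_subset)
    have "reach (A \<union> snd ` S) (X \<inter> edges G) \<subseteq> verts G"
      using edges_subset assms by (intro reach_subset) auto
    then show "finite (reach (A \<union> snd ` S) (X \<inter> edges G))"
      using finite_verts finite_subset by blast
  qed
  also have "\<dots> = influence G (A \<union> snd ` S) {}"
    by (simp add: influence_eq_expectation live_edge_pmf_restrict[OF \<open>finite S\<close>])
  finally show ?thesis .
qed

section \<open>Replacing a feasible solution by a pure seed set\<close>

lemma ex_seed_set_superset:
  assumes "B \<subseteq> verts G" "card B \<le> min k (card (verts G))"
  shows "\<exists>C \<in> seed_sets G k. B \<subseteq> C"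
  using exists_subset_between[of B "min k (card (verts G))" "verts G"] assms finite_verts
  by (auto simp: seed_sets_def)

text \<open>Every node of \<open>B\<close> is paid for by a seed of cost 1 or an edge of cost at
  least \<open>c\<close>, so \<open>c * card B \<le> k\<close>. If \<open>B\<close> fits the budget
  it is padded; otherwise its best-ratio \<open>k\<close>-subset keeps the fraction
  \<open>k / card B\<close>, which is at least \<open>c\<close>.\<close>

lemma ex_seed_set_influence_ge:
  assumes c: "0 < c" "c \<le> 1" and cost: "costs_at_least c G" and feas: "bima_feasible G k A S"
  shows "\<exists>C \<in> seed_sets G k. c * influence G A S \<le> influence G C {}"
proof -
  have A: "A \<subseteq> verts G" and S: "S \<subseteq> verts G \<times> verts G"
    and budget: "real (card A) + (\<Sum>e\<in>S. cost G e) \<le> real k"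
    using feas by (auto simp: bima_feasible_def)
  define B where "B = A \<union> snd ` S"
  have B: "B \<subseteq> verts G" using A S by (auto simp: B_def)
  have finS: "finite S" using S finite_verts finite_subset by blast
  have "card B \<le> card A + card (snd ` S)" unfolding B_def by (rule card_Un_le)
  also have "\<dots> \<le> card A + card S" using card_image_le[OF finS] by simp
  finally have "c * real (card B) \<le> c * real (card A) + c * real (card S)"
    using c by (simp flip: distrib_left of_nat_add)
  also have "\<dots> \<le> real (card A) + (\<Sum>e\<in>S. cost G e)"
  proof (rule add_mono)
    show "c * real (card A) \<le> real (card A)" using c by (simp add: mult_left_le_one_le)
    have "(\<Sum>e\<in>S. c) \<le> (\<Sum>e\<in>S. cost G e)"
      using S cost by (intro sum_mono) (auto simp: costs_at_least_def)
    then show "c * real (card S) \<le> (\<Sum>e\<in>S. cost G e)" by (simp add: mult.commute)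
  qed
  finally have cB: "c * real (card B) \<le> real k" using budget by simp
  have le: "influence G A S \<le> influence G B {}"
    unfolding B_def using A S by (rule influence_added_edges_le)
  have cardB: "card B \<le> card (verts G)" using B finite_verts by (rule card_mono[rotated])
  show ?thesis
  proof (cases "card B \<le> k")
    case True
    then obtain C where C: "C \<in> seed_sets G k" "B \<subseteq> C"
      using ex_seed_set_superset[OF B] cardB by auto
    have "influence G B {} \<le> influence G C {}"
      using C by (intro influence_mono) (auto simp: seed_sets_def)
    moreover have "c * influence G A S \<le> influence G A S"
      using c influence_nonneg by (simp add: mult_left_le_one_le)
    ultimately show ?thesis using C le by force
  next
    case False
    have "finite B" using B finite_verts finite_subset by blast
    then obtain C where C: "C \<subseteq> B" "card C = k"
      "real k * influence G B {} \<le> real (card B) * influence G C {}"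
      using submodular_on_ex_subset_ratio[OF influence_submodular _ _ B, of k] False
        influence_nonneg by auto
    have "real (card B) * (c * influence G A S) \<le> real (card B) * (c * influence G B {})"
      using le c by (intro mult_left_mono) auto
    also have "\<dots> = (c * real (card B)) * influence G B {}" by simp
    also have "\<dots> \<le> real k * influence G B {}"
      using cB influence_nonneg by (intro mult_right_mono)
    also note C(3)
    finally have "c * influence G A S \<le> influence G C {}" using False by simp
    \<comment> \<open>Here \<open>k < card B \<le> card (verts G)\<close>, so the prescribed size is
      \<open>k\<close> itself.\<close>
    moreover have "C \<in> seed_sets G k" using C B False cardB by (auto simp: seed_sets_def)
    ultimately show ?thesis by blast
  qed
qed

lemma bima_feasible_seeds:
  assumes "A \<subseteq> verts G" "card A \<le> k"
  shows "bima_feasible G k A {}"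
  using assms by (auto simp: bima_feasible_def)

lemma optimal_seed_set_approx:
  assumes "0 < c" "c \<le> 1" "costs_at_least c G" "optimal_seed_set G k A"
  shows "bima_approx c G k A {}"
  unfolding bima_approx_def
proof (intro conjI allI impI)
  show "bima_feasible G k A {}"
    using assms(4) by (intro bima_feasible_seeds) (auto simp: optimal_seed_set_def seed_sets_def)
  fix A' S' assume "bima_optimal G k A' S'"
  then obtain C where "C \<in> seed_sets G k" "c * influence G A' S' \<le> influence G C {}"
    using ex_seed_set_influence_ge[OF assms(1-3)] unfolding bima_optimal_def by blast
  then show "c * influence G A' S' \<le> influence G A {}"
    using assms(4) unfolding optimal_seed_set_def by (meson order_trans)
qed

text \<open>The greedy guarantee is compared directly with the seed set that dominates
  \<open>c\<close> times the BIMA optimum, so no optimal seed set has to be exhibited.\<close>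

lemma greedy_seed_set_approx:
  assumes c: "0 < c" "c \<le> 1" "costs_at_least c G"
    and m: "m = min k (card (verts G))" and A: "A \<subseteq> verts G" "card A \<le> m"
    and greedy: "\<And>U. U \<subseteq> verts G \<Longrightarrow> card U \<le> m \<Longrightarrow>
      influence G U {} - influence G A {} \<le> (1 - 1 / real m) ^ m * influence G U {}"
  shows "bima_approx ((1 - 1 / exp 1) * c) G k A {}"
  unfolding bima_approx_def
proof (intro conjI allI impI)
  show "bima_feasible G k A {}" using A m by (intro bima_feasible_seeds) auto
  fix A' S' assume "bima_optimal G k A' S'"
  then obtain U where U: "U \<in> seed_sets G k" "c * influence G A' S' \<le> influence G U {}"
    using ex_seed_set_influence_ge[OF c] unfolding bima_optimal_def by blast
  have U': "U \<subseteq> verts G" "card U = m" using U m by (auto simp: seed_sets_def)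
  have "(1 - 1 / exp 1) * influence G U {} \<le> influence G A {}"
  \<comment> \<open>For \<open>m = 0\<close> the power equals 1 and gives no bound, but the only
    competitor is the empty set, of influence 0.\<close>
  proof (cases "m = 0")
    case True
    then have "U = {}" using U' finite_verts by (metis card_0_eq finite_subset)
    then show ?thesis using influence_nonneg by (simp add: influence_empty)
  next
    case False
    then have "(1 - 1 / real m) ^ m * influence G U {} \<le> 1 / exp 1 * influence G U {}"
      using influence_nonneg by (intro mult_right_mono one_minus_inverse_power_le) auto
    then show ?thesis using greedy[of U] U' by (simp add: left_diff_distrib)
  qed
  moreover have "(1 - 1 / exp 1) * c * influence G A' S' \<le> (1 - 1 / exp (1 :: real)) * influence G U {}"
    unfolding mult.assoc using U by (intro mult_left_mono) auto
  ultimately show "(1 - 1 / exp 1) * c * influence G A' S' \<le> influence G A {}"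
    by linarith
qed

end

section \<open>Time-bounded total correctness\<close>

text \<open>\<open>T\<close> is only an upper bound, so branches and iterations of different lengths
  can share one.\<close>

definition runs :: "set_oracle \<Rightarrow> com \<Rightarrow> store \<Rightarrow> nat \<Rightarrow> (store \<Rightarrow> bool) \<Rightarrow> bool" where
  "runs orc p s T Q \<longleftrightarrow> (\<exists>t s'. exec orc p s t s' \<and> t \<le> T \<and> Q s')"

lemma runs_mono: "runs orc p s T Q \<Longrightarrow> T \<le> T' \<Longrightarrow> (\<And>s. Q s \<Longrightarrow> Q' s) \<Longrightarrow> runs orc p s T' Q'"
  unfolding runs_def by (meson order_trans)

text \<open>The bound is left open because \<open>Skip\<close> serves as the short branch of a
  conditional and must match the longer one.\<close>

lemma runs_Skip: "Q s \<Longrightarrow> 1 \<le> T \<Longrightarrow> runs orc Skip s T Q"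
  unfolding runs_def using exec.Skip by blast

lemma runs_NAssign:
  "Q (s\<lparr>nvar := (nvar s)(x := nval d s)\<rparr>) \<Longrightarrow> runs orc (NAssign x d) s 1 Q"
  unfolding runs_def using exec.NAssign by blast

lemma runs_NPut:
  "Q (s\<lparr>narr := put (narr s) a (nval i s) (nval j s) (nval d s)\<rparr>) \<Longrightarrow> runs orc (NPut a i j d) s 1 Q"
  unfolding runs_def using exec.NPut by blast

lemma runs_RAssign:
  "Q (s\<lparr>rvar := (rvar s)(x := rval d s)\<rparr>) \<Longrightarrow> runs orc (RAssign x d) s 1 Q"
  unfolding runs_def using exec.RAssign by blast

lemma runs_Query:
  "orc (node_set a s) (pair_set b s) = Some y \<Longrightarrow> Q (s\<lparr>rvar := (rvar s)(x := y)\<rparr>) \<Longrightarrow>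
    runs orc (Query x a b) s 1 Q"
  unfolding runs_def using exec.Query by blast

text \<open>Nesting \<open>runs\<close> in the postcondition gives symbolic execution without
  intermediate assertions.\<close>

lemma runs_Seq:
  "runs orc p s T (\<lambda>s'. runs orc q s' T' Q) \<Longrightarrow> runs orc (Seq p q) s (T + T') Q"
  unfolding runs_def by (meson exec.Seq add_mono)

lemma runs_Cond:
  assumes "bval b s \<Longrightarrow> runs orc p s T Q" "\<not> bval b s \<Longrightarrow> runs orc q s T Q"
  shows "runs orc (Cond b p q) s (1 + T) Q"
  using assms unfolding runs_def by (meson exec.CondTrue exec.CondFalse add_left_mono)

text \<open>\<open>P\<close> is indexed by the number of finished iterations, which fixes their
  total at \<open>N\<close>. Each costs one extra step for its test, and the failing test costs the
  final 1.\<close>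

lemma runs_While:
  assumes step: "\<And>i s. i < N \<Longrightarrow> P i s \<Longrightarrow> bval b s \<and> runs orc p s T (P (Suc i))"
    and exit: "\<And>s. P N s \<Longrightarrow> \<not> bval b s"
    and "P i s" "i \<le> N"
  shows "runs orc (While b p) s ((N - i) * (T + 1) + 1) (P N)"
  using assms(3,4)
proof (induction "N - i" arbitrary: i s)
  case 0
  then show ?case using exec.WhileFalse[OF exit, of s orc p] unfolding runs_def by auto
next
  case (Suc d)
  then have "i < N" by simp
  with step[OF this] Suc.prems obtain t s' where
    b: "bval b s" and body: "exec orc p s t s'" "t \<le> T" "P (Suc i) s'"
    unfolding runs_def by blast
  have "runs orc (While b p) s' ((N - Suc i) * (T + 1) + 1) (P N)"
    using Suc.hyps body \<open>i < N\<close> by auto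
  then obtain t' s'' where
    rest: "exec orc (While b p) s' t' s''" "t' \<le> (N - Suc i) * (T + 1) + 1" "P N s''"
    unfolding runs_def by blast
  have "(N - i) * (T + 1) = (T + 1) + (N - Suc i) * (T + 1)"
    using \<open>i < N\<close> by (metis Suc_diff_Suc mult_Suc)
  then have "1 + t + t' \<le> (N - i) * (T + 1) + 1" using body rest by linarith
  then show ?case
    using exec.WhileTrue[OF b body(1) rest(1)] rest(3) unfolding runs_def by blast
qed

section \<open>The greedy algorithm\<close>

(* The candidate v is evaluated by incrementing the multiplicity A[v,0] and restoring it afterwards,
   so that no copy of A is needed; nodes already in A are allowed as candidates. *)
definition try_node :: com where
  "try_node =
    Seq (NPut ''A'' (NVar ''v'') (NConst 0) (NAdd (NGet ''A'' (NVar ''v'') (NConst 0)) (NConst 1)))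
   (Seq (Query ''x'' ''A'' ''S'')
   (Seq (Cond (RLess (RVar ''best'') (RVar ''x''))
          (Seq (RAssign ''best'' (RVar ''x'')) (NAssign ''b'' (NVar ''v''))) Skip)
   (Seq (NPut ''A'' (NVar ''v'') (NConst 0) (NSub (NGet ''A'' (NVar ''v'') (NConst 0)) (NConst 1)))
        (NAssign ''v'' (NAdd (NVar ''v'') (NConst 1))))))"

text \<open>The initial values 0 are sound: influence is nonnegative, and node 0 exists whenever a
  round is entered. If the winner is already a seed, only its multiplicity grows.\<close>

definition add_best_node :: com where
  "add_best_node =
    Seq (NAssign ''v'' (NConst 0))
   (Seq (NAssign ''b'' (NConst 0))
   (Seq (RAssign ''best'' (RNat (NConst 0)))
   (Seq (While (NLess (NVar ''v'') (NVar ''n'')) try_node)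
   (Seq (NPut ''A'' (NVar ''b'') (NConst 0) (NAdd (NGet ''A'' (NVar ''b'') (NConst 0)) (NConst 1)))
        (NAssign ''i'' (NAdd (NVar ''i'') (NConst 1)))))))"

definition greedy :: com where
  "greedy =
    While (BAnd (NLess (NVar ''i'') (NVar ''n'')) (NLess (NVar ''i'') (NVar ''k''))) add_best_node"

section \<open>Invariants and running time of the greedy program\<close>

context
  fixes G :: "nat aug_graph" and n k :: nat
  assumes wf: "wf_aug_graph G" and verts: "verts G = {..<n}"
begin

definition seeds :: "(nat \<Rightarrow> nat \<Rightarrow> nat) \<Rightarrow> nat set" where
  "seeds F = {v. F v 0 \<noteq> 0}"

text \<open>The array \<open>F\<close> is a parameter so that the inner loop can assert that
  \<open>A\<close> is restored exactly, multiplicities included.\<close>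

definition greedy_store :: "nat \<Rightarrow> (nat \<Rightarrow> nat \<Rightarrow> nat) \<Rightarrow> store \<Rightarrow> bool" where
  "greedy_store i F s \<longleftrightarrow> nvar s ''n'' = n \<and> nvar s ''k'' = k \<and> nvar s ''i'' = i \<and>
     narr s ''A'' = F \<and> narr s ''S'' = (\<lambda>_ _. 0)"

text \<open>The value \<open>best\<close> is only bounded by the influence of its witness, which
  admits the initial value 0.\<close>

definition best_among :: "nat \<Rightarrow> (nat \<Rightarrow> nat \<Rightarrow> nat) \<Rightarrow> nat \<Rightarrow> store \<Rightarrow> bool" where
  "best_among i F j s \<longleftrightarrow> greedy_store i F s \<and> nvar s ''v'' = j \<and> nvar s ''b'' < n \<and>
     rvar s ''best'' \<le> influence G (insert (nvar s ''b'') (seeds F)) {} \<and>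
     (\<forall>v<j. influence G (insert v (seeds F)) {} \<le> rvar s ''best'')"

text \<open>The bound is 7, written as the nested sum that the rules produce.\<close>

lemma runs_try_node:
  assumes "j < n" and seeds: "seeds F \<subseteq> verts G" and inv: "best_among i F j s"
  shows "runs (influence_oracle G) try_node s (1 + (1 + ((1 + (1 + 1)) + (1 + 1)))) (best_among i F (Suc j))"
proof -
  have orc: "influence_oracle G (insert j (seeds F)) {} = Some (influence G (insert j (seeds F)) {})"
    using assms verts by (auto simp: influence_oracle_def)
  have upd: "{v. (F(j := (F j)(0 := Suc (F j 0)))) v 0 \<noteq> 0} = insert j (seeds F)"
    by (auto simp: seeds_def)
  have restore: "F(j := (F j)(0 := F j 0)) = F" by simp
  show ?thesis
    unfolding try_node_def
    apply (rule runs_Seq, rule runs_NPut, rule runs_Seq,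
        rule runs_Query[where y = "influence G (insert j (seeds F)) {}"])
    subgoal using inv orc upd
      by (simp add: best_among_def greedy_store_def node_set_def pair_set_def put_def)
    apply (rule runs_Seq, rule runs_Cond)
    subgoal
      apply (rule runs_Seq, rule runs_RAssign, rule runs_NAssign, rule runs_Seq, rule runs_NPut,
          rule runs_NAssign)
      using inv \<open>j < n\<close>
      by (force simp: best_among_def greedy_store_def put_def less_Suc_eq)
    subgoal
      apply (rule runs_Skip, rule runs_Seq, rule runs_NPut, rule runs_NAssign)
      using inv \<open>j < n\<close>
      by (force simp: best_among_def greedy_store_def put_def less_Suc_eq)+
    done
qed

text \<open>The cardinality is only bounded by \<open>i\<close>, since a round may pick a node that
  is already a seed.\<close>

definition greedy_inv :: "nat \<Rightarrow> store \<Rightarrow> bool" where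
  "greedy_inv i s \<longleftrightarrow> (let m = min k n; A = seeds (narr s ''A'') in
     greedy_store i (narr s ''A'') s \<and> A \<subseteq> verts G \<and> card A \<le> i \<and>
     (\<forall>U. U \<subseteq> verts G \<longrightarrow> card U \<le> m \<longrightarrow>
       influence G U {} - influence G A {} \<le> (1 - 1 / real m) ^ i * influence G U {}))"

text \<open>Separates the mathematics of one round from its symbolic execution: the upper and lower
  bounds on \<open>best\<close> together make \<open>b\<close> an optimal extension.\<close>

lemma greedy_inv_step:
  assumes "i < min k n" and inv: "greedy_inv i s" and best: "best_among i (narr s ''A'') n s1"
    and s2: "greedy_store (Suc i) F2 s2" "seeds F2 = insert (nvar s1 ''b'') (seeds (narr s ''A''))"
  shows "greedy_inv (Suc i) s2"
proof -
  define A where "A = seeds (narr s ''A'')"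
  define b where "b = nvar s1 ''b''"
  have A: "A \<subseteq> verts G" "card A \<le> i" using inv by (auto simp: greedy_inv_def Let_def A_def)
  have b: "b \<in> verts G" using best verts by (auto simp: best_among_def b_def)
  have best': "influence G (insert v A) {} \<le> influence G (insert b A) {}" if "v \<in> verts G" for v
    using best that verts by (force simp: best_among_def b_def A_def)
  have mono: "influence G A {} \<le> influence G (insert b A) {}"
    using A b by (intro influence_mono[OF wf]) auto
  have step: "influence G U {} - influence G (insert b A) {}
      \<le> (1 - 1 / real (min k n)) ^ Suc i * influence G U {}"
    if U: "U \<subseteq> verts G" "card U \<le> min k n" for U
  proof (rule greedy_step[OF influence_submodular[OF wf] influence_mono[OF wf]
        finite_verts[OF wf] A(1) U _ best' mono])
    show "influence G U {} - influence G A {} \<le> (1 - 1 / real (min k n)) ^ i * influence G U {}"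
      using inv U unfolding greedy_inv_def Let_def A_def by blast
  qed (use \<open>i < min k n\<close> in auto)
  have F2: "narr s2 ''A'' = F2" using s2 by (simp add: greedy_store_def)
  have "card (insert b A) \<le> Suc i" using A card_insert_le_m1[of "Suc i" A b] by simp
  then show ?thesis
    using s2 step A b unfolding greedy_inv_def Let_def F2 s2(2) A_def[symmetric] b_def[symmetric]
    by auto
qed

text \<open>The bound counts \<open>n\<close> iterations of 7 steps plus a test, the failing test,
  and five assignments.\<close>

lemma runs_add_best_node:
  assumes i: "i < min k n" and inv: "greedy_inv i s"
  shows "runs (influence_oracle G) add_best_node s (8 * n + 6) (greedy_inv (Suc i))"
proof -
  define F where "F = narr s ''A''"
  have F: "seeds F \<subseteq> verts G" "greedy_store i F s"
    using inv by (auto simp: greedy_inv_def Let_def F_def)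
  have loop: "runs (influence_oracle G) (While (NLess (NVar ''v'') (NVar ''n'')) try_node) s'
      (n * (7 + 1) + 1) (best_among i F n)" if "best_among i F 0 s'" for s'
  proof -
    have "runs (influence_oracle G) (While (NLess (NVar ''v'') (NVar ''n'')) try_node) s'
      ((n - 0) * (7 + 1) + 1) (best_among i F n)"
    proof (rule runs_While[where P = "best_among i F" and N = n and i = 0 and T = 7])
      fix j s assume "j < n" "best_among i F j s"
      then show "bval (NLess (NVar ''v'') (NVar ''n'')) s \<and>
          runs (influence_oracle G) try_node s 7 (best_among i F (Suc j))"
        using runs_mono[OF runs_try_node[OF _ F(1)]]
        by (auto simp: best_among_def greedy_store_def)
    qed (use that in \<open>auto simp: best_among_def greedy_store_def\<close>)
    then show ?thesis by simp
  qed
  have "runs (influence_oracle G) add_best_node s (1 + (1 + (1 + ((n * (7 + 1) + 1) + (1 + 1)))))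
      (greedy_inv (Suc i))"
    unfolding add_best_node_def
    apply (rule runs_Seq, rule runs_NAssign, rule runs_Seq, rule runs_NAssign, rule runs_Seq,
        rule runs_RAssign, rule runs_Seq, rule runs_mono[OF loop order_refl])
    subgoal
      using F i influence_nonneg[OF wf] by (auto simp: best_among_def greedy_store_def)
    apply (rule runs_Seq, rule runs_NPut, rule runs_NAssign)
    subgoal for s1
      by (rule greedy_inv_step[OF i inv, of s1])
        (auto simp: F_def best_among_def greedy_store_def put_def seeds_def)
    done
  then show ?thesis by (rule runs_mono) auto
qed

lemma runs_greedy:
  "runs (influence_oracle G) greedy (input_store G k) (min k n * (8 * n + 7) + 1) (greedy_inv (min k n))"
proof -
  have "card (verts G) = n" using verts by simp
  \<comment> \<open>With exponent 0 and no seeds, the gap bound holds because influence is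
    nonnegative.\<close>
  then have init: "greedy_inv 0 (input_store G k)"
    using influence_nonneg[OF wf]
    by (auto simp: greedy_inv_def greedy_store_def input_store_def seeds_def Let_def)
  have "runs (influence_oracle G) greedy (input_store G k)
      ((min k n - 0) * ((8 * n + 6) + 1) + 1) (greedy_inv (min k n))"
    unfolding greedy_def
  proof (rule runs_While[where P = greedy_inv and N = "min k n" and i = 0 and T = "8 * n + 6"])
    fix i s assume "i < min k n" "greedy_inv i s"
    then show "bval (BAnd (NLess (NVar ''i'') (NVar ''n'')) (NLess (NVar ''i'') (NVar ''k''))) s \<and>
        runs (influence_oracle G) add_best_node s (8 * n + 6) (greedy_inv (Suc i))"
      using runs_add_best_node by (auto simp: greedy_inv_def greedy_store_def Let_def)
  qed (use init in \<open>auto simp: greedy_inv_def greedy_store_def Let_def\<close>)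
  then show ?thesis by (rule runs_mono) auto
qed

lemma greedy_inv_approx:
  assumes "0 < c" "c \<le> 1" "costs_at_least c G" and inv: "greedy_inv (min k n) s"
  shows "bima_approx ((1 - 1 / exp 1) * c) G k (node_set ''A'' s) (pair_set ''S'' s)"
proof -
  have A: "node_set ''A'' s = seeds (narr s ''A'')" by (simp add: node_set_def seeds_def)
  have S: "pair_set ''S'' s = {}"
    using inv by (simp add: greedy_inv_def greedy_store_def Let_def pair_set_def)
  show ?thesis
    unfolding A S using inv verts
    by (intro greedy_seed_set_approx[OF wf assms(1-3), where m = "min k n"])
      (auto simp: greedy_inv_def Let_def)
qed

end

lemma greedy_poly_time:
  assumes "0 < c" "c \<le> 1"
  shows "poly_time_bima_approx greedy ((1 - 1 / exp 1) * c) (costs_at_least c)"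
  unfolding poly_time_bima_approx_def
\<comment> \<open>This is \<open>N * (8 * N + 7) + 1\<close> with \<open>N\<close> the input
  size.\<close>
proof (intro exI[of _ "[:1, 7, 8:]"] allI impI)
  fix G :: "nat aug_graph" and n k
  assume *: "wf_aug_graph G \<and> verts G = {..<n} \<and> costs_at_least c G"
  then obtain t s where run: "exec (influence_oracle G) greedy (input_store G k) t s"
    "t \<le> min k n * (8 * n + 7) + 1" "greedy_inv G n k (min k n) s"
    using runs_greedy[of G n k] unfolding runs_def by blast
  define N where "N = input_size G k"
  have "n \<le> N" using * by (simp add: N_def input_size_def)
  \<comment> \<open>Bounding the number of rounds by \<open>n\<close> matters: \<open>k\<close>
    itself may be exponential in its binary length.\<close>
  then have "min k n * (8 * n + 7) \<le> N * (8 * N + 7)" by (intro mult_le_mono) auto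
  then have "t \<le> poly [:1, 7, 8:] N" using run(2) by (simp add: algebra_simps)
  then show "\<exists>t s. exec (influence_oracle G) greedy (input_store G k) t s \<and>
      t \<le> poly [:1, 7, 8:] (input_size G k) \<and>
      bima_approx ((1 - 1 / exp 1) * c) G k (node_set ''A'' s) (pair_set ''S'' s)"
    using run greedy_inv_approx[of G n c k s] * assms unfolding N_def by blast
qed

theorem mainTheorem3:
  fixes c_min :: real
  assumes "0 < c_min" and "c_min \<le> 1"
  shows "(\<forall>(G :: 'v aug_graph) (k :: nat) A.
            wf_aug_graph G \<and> costs_at_least c_min G \<and> optimal_seed_set G k A \<longrightarrow>
            bima_approx c_min G k A {}) \<and>
         (\<exists>p. poly_time_bima_approx p ((1 - 1 / exp 1) * c_min) (costs_at_least c_min))"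
  using optimal_seed_set_approx greedy_poly_time assms by blast

end
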